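(* Let $\mathcal{H}$ be a nontrivial complex Hilbert space, let $A\in\mathcal{B}(\mathcal{H})$ be positive and nonzero, and let $T\in\mathcal{B}_{A^{1/2}}(\mathcal{H})$. Then the following assertions are equivalent: (1) $d\omega_A(T)=\sqrt{\omega_A(T)^2+\|T\|_A^4}$. (2) $T\parallel_A I$, where $I$ is the identity operator on $\mathcal{H}$. (3) $T$ is $A$-normaloid. (4) $\omega_A(T)^2A\geq T^*AT$.
   Context: $\mathcal{B}(\mathcal{H})$ denotes the bounded linear operators on $\mathcal{H}$. For $P,Q\in\mathcal{B}(\mathcal{H})$, $P\ge Q$ means $\langle Px,x\rangle\ge\langle Qx,x\rangle$ for all $x\in\mathcal{H}$; $A$ positive means $A\ge0$. Put $\langle x,y\rangle_A=\langle Ax,y\rangle$ and $\|x\|_A=\sqrt{\langle x,x\rangle_A}$. $\mathcal{B}_{A^{1/2}}(\mathcal{H})$ is the set of $A$-bounded operators, i.e. those $T\in\mathcal{B}(\mathcal{H})$ for which there is $c>0$ with $\|Tx\|_A\le c\|x\|_A$ for all $x\in\mathcal{H}$; for such $T$, $\|T\|_A=\sup\{\|Tx\|_A : x\in\mathcal{H},\ \|x\|_A=1\}$. The $A$-numerical radius is $\omega_A(T)=\sup\{|\langle Tx,x\rangle_A| : \|x\|_A=1\}$. The $A$-Davis-Wielandt radius is $d\omega_A(T)=\sup\{\sqrt{|\langle Tx,x\rangle_A|^2+\|Tx\|_A^4} : \|x\|_A=1\}$. The $A$-spectral radius is $r_A(T)=\inf_{n\ge1}\|T^n\|_A^{1/n}=\lim_{n\to\infty}\|T^n\|_A^{1/n}$,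 and $T$ is $A$-normaloid if $r_A(T)=\|T\|_A$. For $T,S\in\mathcal{B}_{A^{1/2}}(\mathcal{H})$, $T\parallel_A S$ ($A$-norm-parallel) means that there is $\lambda\in\mathbb{C}$ with $|\lambda|=1$ and $\|T+\lambda S\|_A=\|T\|_A+\|S\|_A$. *)

theory Defs
  imports "HOL-Analysis.Analysis" "HOL-Library.Complex_Order"
begin

(* Complex Hilbert spaces. The complex inner product is linear in its first argument.
   The superclass real_inner supplies the underlying real inner product Re <x,y>, and with it
   positive definiteness, the norm, and the metric; see cinner_self below. *)

class complex_inner = real_inner +
  fixes scaleC :: "complex \<Rightarrow> 'a \<Rightarrow> 'a" (infixr "*\<^sub>C" 75)
    and cinner :: "'a \<Rightarrow> 'a \<Rightarrow> complex"
  assumes scaleC_add_right: "a *\<^sub>C (x + y) = a *\<^sub>C x + a *\<^sub>C y"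
    and scaleC_add_left: "(a + b) *\<^sub>C x = a *\<^sub>C x + b *\<^sub>C x"
    and scaleC_scaleC: "a *\<^sub>C (b *\<^sub>C x) = (a * b) *\<^sub>C x"
    and scaleC_of_real: "complex_of_real r *\<^sub>C x = r *\<^sub>R x"
    and cinner_commute: "cinner x y = cnj (cinner y x)"
    and cinner_add_left: "cinner (x + y) z = cinner x z + cinner y z"
    and cinner_scaleC_left: "cinner (a *\<^sub>C x) y = a * cinner x y"
    and inner_eq_Re_cinner: "inner x y = Re (cinner x y)"

class chilbert_space = complex_inner + complete_space

lemma cinner_self: "cinner x x = complex_of_real ((norm x)\<^sup>2)"
  for x :: "'a::complex_inner"
proof -
  have "Im (cinner x x) = 0"
    using cinner_commute[of x x] by (metis Reals_cnj_iff complex_is_Real_iff)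
  then show ?thesis
    by (simp add: complex_eq_iff power2_norm_eq_inner inner_eq_Re_cinner)
qed

definition bounded_clinear :: "('a::complex_inner \<Rightarrow> 'a) \<Rightarrow> bool" where
  "bounded_clinear T \<longleftrightarrow> bounded_linear T \<and> (\<forall>c x. T (c *\<^sub>C x) = c *\<^sub>C T x)"

(* Well defined for bounded_clinear T on a chilbert_space, by the Riesz representation theorem. *)
definition cadjoint :: "('a::chilbert_space \<Rightarrow> 'a) \<Rightarrow> 'a \<Rightarrow> 'a" where
  "cadjoint T = (THE S. \<forall>x y. cinner (T x) y = cinner x (S y))"

(* The order on complex numbers is the one of Complex_Order:
   z \<le> w iff Re z \<le> Re w and Im z = Im w. So positivity of an operator includes
   that its quadratic form is real-valued. *)
definition op_ge :: "('a::complex_inner \<Rightarrow> 'a) \<Rightarrow> ('a \<Rightarrow> 'a) \<Rightarrow> bool" where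
  "op_ge P Q \<longleftrightarrow> (\<forall>x. cinner (P x) x \<ge> cinner (Q x) x)"

definition op_positive :: "('a::complex_inner \<Rightarrow> 'a) \<Rightarrow> bool" where
  "op_positive A \<longleftrightarrow> op_ge A (\<lambda>x. 0)"

definition A_inner :: "('a::complex_inner \<Rightarrow> 'a) \<Rightarrow> 'a \<Rightarrow> 'a \<Rightarrow> complex" where
  "A_inner A x y = cinner (A x) y"

definition A_norm :: "('a::complex_inner \<Rightarrow> 'a) \<Rightarrow> 'a \<Rightarrow> real" where
  "A_norm A x = sqrt (Re (A_inner A x x))"

definition A_bounded :: "('a::complex_inner \<Rightarrow> 'a) \<Rightarrow> ('a \<Rightarrow> 'a) \<Rightarrow> bool" where
  "A_bounded A T \<longleftrightarrow>
     bounded_clinear T \<and> (\<exists>c>0. \<forall>x. A_norm A (T x) \<le> c * A_norm A x)"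

(* For positive nonzero A and A-bounded T the suprema below are over nonempty bounded sets. *)

definition A_opnorm :: "('a::complex_inner \<Rightarrow> 'a) \<Rightarrow> ('a \<Rightarrow> 'a) \<Rightarrow> real" where
  "A_opnorm A T = Sup {A_norm A (T x) | x. A_norm A x = 1}"

definition A_numerical_radius :: "('a::complex_inner \<Rightarrow> 'a) \<Rightarrow> ('a \<Rightarrow> 'a) \<Rightarrow> real" where
  "A_numerical_radius A T = Sup {cmod (A_inner A (T x) x) | x. A_norm A x = 1}"

definition A_Davis_Wielandt_radius ::
    "('a::complex_inner \<Rightarrow> 'a) \<Rightarrow> ('a \<Rightarrow> 'a) \<Rightarrow> real" where
  "A_Davis_Wielandt_radius A T =
     Sup {sqrt ((cmod (A_inner A (T x) x))\<^sup>2 + A_norm A (T x) ^ 4) | x. A_norm A x = 1}"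

definition A_spectral_radius :: "('a::complex_inner \<Rightarrow> 'a) \<Rightarrow> ('a \<Rightarrow> 'a) \<Rightarrow> real" where
  "A_spectral_radius A T = (INF n\<in>{1..}. root n (A_opnorm A (T ^^ n)))"

definition A_normaloid :: "('a::complex_inner \<Rightarrow> 'a) \<Rightarrow> ('a \<Rightarrow> 'a) \<Rightarrow> bool" where
  "A_normaloid A T \<longleftrightarrow> A_spectral_radius A T = A_opnorm A T"

definition A_norm_parallel ::
    "('a::complex_inner \<Rightarrow> 'a) \<Rightarrow> ('a \<Rightarrow> 'a) \<Rightarrow> ('a \<Rightarrow> 'a) \<Rightarrow> bool" where
  "A_norm_parallel A T S \<longleftrightarrow>
     (\<exists>l. cmod l = 1 \<and> A_opnorm A (\<lambda>x. T x + l *\<^sub>C S x) = A_opnorm A T + A_opnorm A S)"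

end

theory Submission
  imports Defs
begin

text \<open>Each of the four assertions is equivalent to \<open>\<omega>\<^sub>A(T) = \<parallel>T\<parallel>\<^sub>A\<close>. If this equality holds, unit vectors
  \<open>x\<close> that almost attain the numerical radius almost attain the norm as well and are approximate
  eigenvectors of \<open>T\<close> for eigenvalues of modulus \<open>\<parallel>T\<parallel>\<^sub>A\<close>. Conversely, parallelism to the identity
  forces \<open>\<omega>\<^sub>A(T) \<ge> \<parallel>T\<parallel>\<^sub>A\<close> on expanding \<open>\<parallel>Tx + \<lambda>x\<parallel>\<^sub>A\<^sup>2\<close>; normaloidity does so through
  \<open>\<parallel>T\<^sup>n\<parallel>\<^sub>A \<le> 2 \<omega>\<^sub>A(T\<^sup>n) \<le> 2 \<omega>\<^sub>A(T)\<^sup>n\<close> for \<open>n\<close> a power of two; and the Davis-Wielandt equality provides unit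
  vectors that almost attain numerical radius and norm simultaneously, which gives an approximate
  eigenvector of the adjoint for an eigenvalue of modulus \<open>\<parallel>T\<parallel>\<^sub>A\<close>.\<close>

section \<open>Complex scalars, linear maps and sequences approximating suprema\<close>

lemma scaleC_minus1 [simp]: "(-1) *\<^sub>C x = - x" for x :: "'a::complex_inner"
  using scaleC_of_real[of "-1" x] by simp

lemma scaleC_one [simp]: "1 *\<^sub>C x = x" for x :: "'a::complex_inner"
  using scaleC_of_real[of 1 x] by simp

lemma scaleC_zero_left [simp]: "0 *\<^sub>C x = 0" for x :: "'a::complex_inner"
  using scaleC_of_real[of 0 x] by simp

lemma cinner_add_right: "cinner x (y + z) = cinner x y + cinner x z" for x :: "'a::complex_inner"
  by (metis cinner_add_left cinner_commute complex_cnj_add)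

lemma cinner_scaleC_right: "cinner x (a *\<^sub>C y) = cnj a * cinner x y" for x :: "'a::complex_inner"
  by (metis cinner_commute cinner_scaleC_left complex_cnj_mult)

definition clinear :: "('a::complex_inner \<Rightarrow> 'a) \<Rightarrow> bool" where
  "clinear T \<longleftrightarrow> (\<forall>x y. T (x + y) = T x + T y) \<and> (\<forall>c x. T (c *\<^sub>C x) = c *\<^sub>C T x)"

lemma bounded_clinear_imp_clinear: "bounded_clinear T \<Longrightarrow> clinear T"
  by (simp add: bounded_clinear_def clinear_def bounded_linear_def linear_add)

lemma clinear_add: "clinear T \<Longrightarrow> T (x + y) = T x + T y"
  and clinear_scaleC: "clinear T \<Longrightarrow> T (c *\<^sub>C x) = c *\<^sub>C T x"
  by (simp_all add: clinear_def)

lemma clinear_minus: "clinear T \<Longrightarrow> T (- x) = - T x"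
  using clinear_scaleC[of T "-1" x] by simp

lemma clinear_diff: "clinear T \<Longrightarrow> T (x - y) = T x - T y"
  using clinear_add[of T x "- y"] by (simp add: clinear_minus)

lemma clinear_funpow: "clinear T \<Longrightarrow> clinear (T ^^ n)"
  by (induction n) (auto simp: clinear_def)

lemma clinear_scaleC_comp: "clinear T \<Longrightarrow> clinear (\<lambda>x. c *\<^sub>C T x)"
  by (simp add: clinear_def scaleC_add_right scaleC_scaleC mult.commute)

lemma ex_unimodular_phase:
  fixes z :: complex
  obtains c where "cmod c = 1" "c * z = complex_of_real (cmod z)"
proof (cases "z = 0")
  case True
  then show thesis by (intro that[of 1]) auto
next
  case False
  then show thesis
    using complex_norm_square[of z]
    by (intro that[of "cnj z / cmod z"])
       (auto simp: norm_divide power2_eq_square field_simps)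
qed

text \<open>The suprema over unit vectors need not be attained, so maximizing sequences take the
  place of maximizers.\<close>

lemma ex_seq_tendsto_Sup:
  fixes f :: "'b \<Rightarrow> real"
  assumes "\<exists>x. P x" and "\<And>x. P x \<Longrightarrow> f x \<le> c"
  obtains X where "\<And>n. P (X n)" "(\<lambda>n. f (X n)) \<longlonglongrightarrow> Sup {f x | x. P x}"
proof -
  have "Sup {f x | x. P x} \<in> closure {f x | x. P x}"
    using assms by (intro closure_contains_Sup) (auto intro!: bdd_aboveI[of _ c])
  then obtain u where u: "\<And>n. u n \<in> {f x | x. P x}" "u \<longlonglongrightarrow> Sup {f x | x. P x}"
    unfolding closure_sequential by blast
  then have "\<forall>n. \<exists>x. P x \<and> u n = f x" by auto
  then obtain X where "\<And>n. P (X n)" "\<And>n. u n = f (X n)" by metis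
  moreover from this have "u = (\<lambda>n. f (X n))" by blast
  ultimately show thesis using u(2) that by blast
qed

section \<open>Positive semidefinite sesquilinear forms, possibly degenerate\<close>

locale positive_form =
  fixes h :: "'a::complex_inner \<Rightarrow> 'a \<Rightarrow> complex"
  assumes add_left: "h (x + y) z = h x z + h y z"
    and scaleC_left: "h (c *\<^sub>C x) y = c * h x y"
    and add_right: "h x (y + z) = h x y + h x z"
    and scaleC_right: "h x (c *\<^sub>C y) = cnj c * h x y"
    and Re_nonneg: "Re (h x x) \<ge> 0"
    and Im_zero: "Im (h x x) = 0"
begin

definition seminorm :: "'a \<Rightarrow> real" where "seminorm x = sqrt (Re (h x x))"

lemma minus_left: "h (- x) y = - h x y"
  using scaleC_left[of "-1" x y] by simp

lemma minus_right: "h x (- y) = - h x y"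
  using scaleC_right[of x "-1" y] by simp

lemma diff_left: "h (x - y) z = h x z - h y z"
  using add_left[of x "- y" z] by (simp add: minus_left)

lemma diff_right: "h x (y - z) = h x y - h x z"
  using add_right[of x y "- z"] by (simp add: minus_right)

text \<open>Polarization: the diagonal values at \<open>x + y\<close> and at
  \<open>x + \<i> *\<^sub>C y\<close> are real, which yields the imaginary and the real part
  respectively.\<close>

lemma hermitian: "h x y = cnj (h y x)"
proof (rule complex_eqI)
  show "Im (h x y) = Im (cnj (h y x))"
    using Im_zero[of "x + y"] Im_zero[of x] Im_zero[of y]
    by (simp add: add_left add_right)
  show "Re (h x y) = Re (cnj (h y x))"
    using Im_zero[of "x + \<i> *\<^sub>C y"] Im_zero[of x] Im_zero[of y]
    by (simp add: add_left add_right scaleC_left scaleC_right)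
qed

lemma seminorm_nonneg [simp]: "seminorm x \<ge> 0"
  by (simp add: seminorm_def Re_nonneg)

lemma self_eq: "h x x = complex_of_real ((seminorm x)\<^sup>2)"
  by (simp add: complex_eq_iff seminorm_def Re_nonneg Im_zero)

lemma Re_self: "Re (h x x) = (seminorm x)\<^sup>2"
  by (simp add: self_eq)

lemma seminorm_scaleC: "seminorm (c *\<^sub>C x) = cmod c * seminorm x"
proof -
  have "h (c *\<^sub>C x) (c *\<^sub>C x) = of_real ((cmod c)\<^sup>2) * h x x"
    unfolding complex_norm_square by (simp add: scaleC_left scaleC_right)
  also have "\<dots> = of_real ((cmod c * seminorm x)\<^sup>2)"
    by (simp add: self_eq power_mult_distrib)
  finally have "Re (h (c *\<^sub>C x) (c *\<^sub>C x)) = (cmod c * seminorm x)\<^sup>2"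
    by (metis Re_complex_of_real)
  then show ?thesis
    by (simp add: seminorm_def[of "c *\<^sub>C x"])
qed

lemma seminorm_minus: "seminorm (- x) = seminorm x"
  using seminorm_scaleC[of "-1" x] by simp

text \<open>Expanding the form at \<open>x - c *\<^sub>C y\<close> with \<open>c = t * h x y\<close>
  gives a nonnegative quadratic in the real parameter \<open>t\<close>. If \<open>q\<close> is
  nonzero, it is evaluated at its minimum \<open>t = 1 / q\<close>; degenerate \<open>y\<close> need
  the separate case.\<close>

lemma Cauchy_Schwarz_sq: "(cmod (h x y))\<^sup>2 \<le> (seminorm x)\<^sup>2 * (seminorm y)\<^sup>2"
proof -
  define k where "k = (cmod (h x y))\<^sup>2"
  define p where "p = (seminorm x)\<^sup>2"
  define q where "q = (seminorm y)\<^sup>2"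
  have 1: "0 \<le> p - 2 * t * k + t\<^sup>2 * k * q" for t :: real
  proof -
    define c where "c = complex_of_real t * h x y"
    have e: "h x y * cnj (h x y) = of_real k" "cnj (h x y) * h x y = of_real k"
      unfolding k_def by (metis complex_norm_square mult.commute)+
    have "h (x - c *\<^sub>C y) (x - c *\<^sub>C y)
        = h x x - cnj c * h x y - c * cnj (h x y) + c * cnj c * h y y"
      by (simp add: diff_left diff_right scaleC_left scaleC_right hermitian[of y x] algebra_simps)
    also have "\<dots> = h x x - t * (cnj (h x y) * h x y) - t * (h x y * cnj (h x y))
        + t * t * (h x y * cnj (h x y)) * h y y"
      by (simp add: c_def algebra_simps)
    also have "\<dots> = of_real (p - 2 * t * k + t\<^sup>2 * k * q)"
      unfolding e self_eq p_def[symmetric] q_def[symmetric] by (simp add: power2_eq_square)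
    finally show ?thesis
      using Re_nonneg[of "x - c *\<^sub>C y"] by simp
  qed
  have k0: "k \<ge> 0" and q0: "q \<ge> 0" by (simp_all add: k_def q_def)
  have "k \<le> p * q"
  proof (cases "q = 0")
    case True
    have "k = 0"
    proof (rule ccontr)
      assume "k \<noteq> 0"
      \<comment> \<open>For \<open>q = 0\<close> the quadratic is the affine function
        \<open>p - 2 * t * k\<close>, and this \<open>t\<close> gives it the value -1.\<close>
      with 1[of "(p + 1) / (2 * k)"] True show False by (simp add: field_simps)
    qed
    with True show ?thesis by simp
  next
    case False
    with 1[of "1 / q"] q0 show ?thesis by (simp add: field_simps power2_eq_square)
  qed
  then show ?thesis by (simp add: k_def p_def q_def)
qed

lemma Cauchy_Schwarz: "cmod (h x y) \<le> seminorm x * seminorm y"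
  using Cauchy_Schwarz_sq[of x y]
  by (metis mult_nonneg_nonneg power2_le_imp_le power_mult_distrib seminorm_nonneg)

lemma seminorm_add_sq: "(seminorm (x + y))\<^sup>2 = (seminorm x)\<^sup>2 + (seminorm y)\<^sup>2 + 2 * Re (h x y)"
  using hermitian[of y x] by (simp add: Re_self[symmetric] add_left add_right)

lemma seminorm_triangle: "seminorm (x + y) \<le> seminorm x + seminorm y"
proof (rule power2_le_imp_le)
  have "Re (h x y) \<le> seminorm x * seminorm y"
    using complex_Re_le_cmod[of "h x y"] Cauchy_Schwarz[of x y] by linarith
  then show "(seminorm (x + y))\<^sup>2 \<le> (seminorm x + seminorm y)\<^sup>2"
    unfolding seminorm_add_sq by (simp add: power2_sum)
qed simp

lemma seminorm_diff_ge: "seminorm x - seminorm y \<le> seminorm (x - y)"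
  using seminorm_triangle[of "x - y" y] by simp

text \<open>Suppose \<open>T\<close> attains both its numerical radius \<open>w = h (T x) x\<close> and its norm \<open>N > w\<close> at a unit
  vector \<open>x\<close>. Then \<open>T\<^sup>* x = 2wx - Tx\<close> and \<open>T\<^sup>* T x = N\<^sup>2x\<close>, so \<open>z = \<mu>x - Tx\<close> is an eigenvector of
  \<open>T\<^sup>*\<close> for the eigenvalue \<open>\<mu>\<close>, where \<open>\<mu>\<close> is a non-real root of \<open>\<mu>\<^sup>2 - 2w\<mu> + N\<^sup>2\<close>, hence of modulus
  \<open>N\<close>; this contradicts \<open>w < N\<close>. The lemma is the quantitative form of this argument. The
  Cauchy-Schwarz inequality for the defect forms \<open>f\<close> and \<open>g\<close> replaces the adjoint with respect to
  \<open>h\<close>, which need not exist.\<close>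

lemma numerical_radius_gap_bound:
  assumes T: "clinear T"
    and w: "\<And>u. cmod (h (T u) u) \<le> w * (seminorm u)\<^sup>2"
    and N: "\<And>u. seminorm (T u) \<le> N * seminorm u"
    and "0 \<le> w" "w \<le> N"
    and x: "seminorm x = 1" and a: "h (T x) x = complex_of_real a"
  shows "(N - w) * (N\<^sup>2 - w\<^sup>2)
      \<le> N * sqrt (16 * N ^ 3 * (2 * w - 2 * a)) + sqrt (4 * N ^ 4 * (N\<^sup>2 - (seminorm (T x))\<^sup>2))"
proof -
  note lin = clinear_add[OF T] clinear_scaleC[OF T]
  \<comment> \<open>\<open>f\<close> and \<open>g\<close> are the forms of 2w minus T minus its
    adjoint, and of N^2 minus the adjoint times T. Their diagonal values at \<open>x\<close> are
    small when \<open>x\<close> nearly attains numerical radius and norm.\<close>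
  define f where "f = (\<lambda>u v. 2 * of_real w * h u v - h (T u) v - h u (T v))"
  define g where "g = (\<lambda>u v. of_real (N\<^sup>2) * h u v - h (T u) (T v))"
  have N2: "(seminorm (T u))\<^sup>2 \<le> N\<^sup>2 * (seminorm u)\<^sup>2" for u
    using power_mono[OF N[of u], of 2] by (simp add: power_mult_distrib)
  have Refuu: "Re (f u u) = 2 * w * (seminorm u)\<^sup>2 - 2 * Re (h (T u) u)" for u
    using hermitian[of u "T u"] by (simp add: f_def Re_self)
  have Reguu: "Re (g u u) = N\<^sup>2 * (seminorm u)\<^sup>2 - (seminorm (T u))\<^sup>2" for u
    by (simp add: g_def self_eq)
  interpret f: positive_form f
  proof
    show "0 \<le> Re (f u u)" for u
      unfolding Refuu using w[of u] complex_Re_le_cmod[of "h (T u) u"] by linarith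
    show "Im (f u u) = 0" for u
      using hermitian[of u "T u"] by (simp add: f_def self_eq)
  qed (simp_all add: f_def lin add_left add_right scaleC_left scaleC_right algebra_simps)
  interpret g: positive_form g
  proof
    show "0 \<le> Re (g u u)" for u
      unfolding Reguu using N2[of u] by simp
    show "Im (g u u) = 0" for u
      by (simp add: g_def self_eq)
  qed (simp_all add: g_def lin add_left add_right scaleC_left scaleC_right algebra_simps)
  define s where "s = sqrt (N\<^sup>2 - w\<^sup>2)"
  define \<mu> where "\<mu> = Complex w s"
  define z where "z = \<mu> *\<^sub>C x - T x"
  have wN: "w\<^sup>2 \<le> N\<^sup>2" using assms by (intro power_mono) auto
  have s2: "s\<^sup>2 = N\<^sup>2 - w\<^sup>2" using wN by (simp add: s_def)
  have "N \<ge> 0" using assms by simp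
  have cm: "cmod \<mu> = N"
    using s2 \<open>N \<ge> 0\<close> by (simp add: \<mu>_def cmod_def)
  \<comment> \<open>\<open>mm\<close> and \<open>m2\<close> are Vieta's relations for the roots
    \<open>\<mu>\<close> and \<open>cnj \<mu>\<close>.\<close>
  have mm: "cnj \<mu> * \<mu> = of_real (N\<^sup>2)"
    using cm by (metis complex_norm_square mult.commute)
  have m2: "2 * of_real w = \<mu> + cnj \<mu>"
    by (simp add: \<mu>_def complex_eq_iff)
  \<comment> \<open>The eigenvector relation for the adjoint at \<open>z\<close>, paired with
    \<open>z\<close>; the right-hand side collects the errors caused by the two defects.\<close>
  have key: "h (T z) z - cnj \<mu> * h z z = g z x - cnj \<mu> * f z x"
  proof -
    have e1: "h u z = cnj \<mu> * h u x - h u (T x)" for u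
      by (simp add: z_def diff_right scaleC_right)
    show ?thesis
      unfolding e1 f_def g_def mm[symmetric] m2 by (simp add: algebra_simps)
  qed
  \<comment> \<open>Since \<open>a\<close> is real, the component of \<open>z\<close> along
    \<open>x\<close> has imaginary part \<open>s\<close>, which keeps \<open>z\<close> away from
    zero.\<close>
  have zlow: "s \<le> seminorm z"
  proof -
    have "h z x = \<mu> - of_real a"
      by (simp add: z_def diff_left scaleC_left a self_eq x)
    then have "Im (h z x) = s" by (simp add: \<mu>_def)
    then have "s \<le> cmod (h z x)" using abs_Im_le_cmod[of "h z x"] by linarith
    also have "\<dots> \<le> seminorm z" using Cauchy_Schwarz[of z x] x by simp
    finally show ?thesis .
  qed
  have zup: "seminorm z \<le> 2 * N"
    using seminorm_triangle[of "\<mu> *\<^sub>C x" "- T x"] N[of x] x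
    by (simp add: z_def seminorm_minus seminorm_scaleC cm)
  have z2: "(seminorm z)\<^sup>2 \<le> 4 * N\<^sup>2"
    using power_mono[OF zup, of 2] by (simp add: power_mult_distrib)
  have a_le: "a \<le> w" using w[of x] a x by simp
  have b_le: "(seminorm (T x))\<^sup>2 \<le> N\<^sup>2" using N2[of x] x by simp
  have fzz: "Re (f z z) \<le> 16 * N ^ 3"
  proof -
    have "Re (f z z) \<le> 4 * w * (seminorm z)\<^sup>2"
      unfolding Refuu using w[of z] abs_Re_le_cmod[of "h (T z) z"] by linarith
    also have "\<dots> \<le> 4 * N * (4 * N\<^sup>2)"
      using assms z2 by (intro mult_mono) auto
    finally show ?thesis by (simp add: power2_eq_square power3_eq_cube)
  qed
  have gzz: "Re (g z z) \<le> 4 * N ^ 4"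
  proof -
    have "Re (g z z) \<le> N\<^sup>2 * (seminorm z)\<^sup>2" unfolding Reguu by simp
    also have "\<dots> \<le> N\<^sup>2 * (4 * N\<^sup>2)" using z2 by (intro mult_left_mono) auto
    finally show ?thesis by (simp add: power2_eq_square power4_eq_xxxx)
  qed
  have fzx: "cmod (f z x) \<le> sqrt (16 * N ^ 3 * (2 * w - 2 * a))"
  proof (rule real_le_rsqrt)
    have "(cmod (f z x))\<^sup>2 \<le> Re (f z z) * Re (f x x)"
      using f.Cauchy_Schwarz_sq[of z x] by (simp add: f.Re_self)
    also have "\<dots> \<le> 16 * N ^ 3 * (2 * w - 2 * a)"
      using fzz a_le by (auto simp: Refuu[of x] x a intro!: mult_right_mono)
    finally show "(cmod (f z x))\<^sup>2 \<le> 16 * N ^ 3 * (2 * w - 2 * a)" .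
  qed
  have gzx: "cmod (g z x) \<le> sqrt (4 * N ^ 4 * (N\<^sup>2 - (seminorm (T x))\<^sup>2))"
  proof (rule real_le_rsqrt)
    have "(cmod (g z x))\<^sup>2 \<le> Re (g z z) * Re (g x x)"
      using g.Cauchy_Schwarz_sq[of z x] by (simp add: g.Re_self)
    also have "\<dots> \<le> 4 * N ^ 4 * (N\<^sup>2 - (seminorm (T x))\<^sup>2)"
      unfolding Reguu[of x] x using gzz b_le by (auto intro!: mult_right_mono)
    finally show "(cmod (g z x))\<^sup>2 \<le> 4 * N ^ 4 * (N\<^sup>2 - (seminorm (T x))\<^sup>2)" .
  qed
  have "(N - w) * (N\<^sup>2 - w\<^sup>2) \<le> (N - w) * (seminorm z)\<^sup>2"
  proof -
    have "s \<ge> 0" using wN by (simp add: s_def)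
    then have "s\<^sup>2 \<le> (seminorm z)\<^sup>2" using zlow by (intro power_mono)
    then show ?thesis using s2 \<open>w \<le> N\<close> by (intro mult_left_mono) auto
  qed
  \<comment> \<open>An exact eigenvector \<open>z\<close> would have a numerical value of modulus
    \<open>N * (seminorm z)\<^sup>2\<close>, while at most \<open>w * (seminorm z)\<^sup>2\<close>
    is allowed; the defects must account for the difference.\<close>
  also have "\<dots> \<le> N * cmod (f z x) + cmod (g z x)"
  proof -
    have "N * (seminorm z)\<^sup>2 = cmod (cnj \<mu> * h z z)"
      by (simp add: norm_mult cm self_eq norm_power)
    also have "cnj \<mu> * h z z = h (T z) z + (cnj \<mu> * f z x - g z x)"
      using key by (simp add: algebra_simps)
    also have "cmod \<dots> \<le> cmod (h (T z) z) + (cmod (cnj \<mu> * f z x) + cmod (g z x))"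
      by (meson norm_triangle_ineq norm_triangle_ineq4 add_left_mono order_trans)
    also have "cmod (cnj \<mu> * f z x) = N * cmod (f z x)" by (simp add: norm_mult cm)
    finally show ?thesis using w[of z] by (simp add: algebra_simps)
  qed
  also have "\<dots> \<le> N * sqrt (16 * N ^ 3 * (2 * w - 2 * a))
      + sqrt (4 * N ^ 4 * (N\<^sup>2 - (seminorm (T x))\<^sup>2))"
    using fzx gzx \<open>N \<ge> 0\<close> by (intro add_mono mult_left_mono)
  finally show ?thesis .
qed

text \<open>Polarization and the parallelogram law bound \<open>h (T u) v\<close> by the numerical
  radius. Choosing \<open>v\<close> along \<open>T x\<close> with the length of \<open>x\<close>
  produces the factor 2.\<close>

lemma seminorm_le_2_numerical_radius:
  assumes T: "clinear T" and w: "\<And>u. cmod (h (T u) u) \<le> w * (seminorm u)\<^sup>2"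
  shows "seminorm (T x) \<le> 2 * w * seminorm x"
proof -
  note lin = clinear_add[OF T] clinear_scaleC[OF T] clinear_diff[OF T]
  have pol: "cmod (h (T u) v) \<le> w * ((seminorm u)\<^sup>2 + (seminorm v)\<^sup>2)" for u v
  proof -
    have par: "(seminorm (u + y))\<^sup>2 + (seminorm (u - y))\<^sup>2 = 2 * (seminorm u)\<^sup>2 + 2 * (seminorm y)\<^sup>2" for y
      by (simp add: Re_self[symmetric] add_left add_right diff_left diff_right)
    have iv: "seminorm (\<i> *\<^sub>C v) = seminorm v" by (simp add: seminorm_scaleC)
    define p where "p = (\<lambda>y. h (T (u + y)) (u + y) - h (T (u - y)) (u - y))"
    have p: "cmod (p y) \<le> w * (2 * (seminorm u)\<^sup>2 + 2 * (seminorm y)\<^sup>2)" for y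
      using norm_triangle_ineq4[of "h (T (u + y)) (u + y)" "h (T (u - y)) (u - y)"]
        w[of "u + y"] w[of "u - y"]
      unfolding par[symmetric] p_def by (simp add: distrib_left)
    \<comment> \<open>Here \<open>p y\<close> equals \<open>2 * (h (T u) y + h (T y) u)\<close>;
      passing to \<open>\<i> *\<^sub>C v\<close> flips the relative sign, so the terms
      \<open>h (T v) u\<close> cancel.\<close>
    have "4 * h (T u) v = p v + \<i> * p (\<i> *\<^sub>C v)"
      unfolding p_def
      by (simp add: lin add_left add_right diff_left diff_right scaleC_left scaleC_right algebra_simps)
    then have "4 * cmod (h (T u) v) \<le> cmod (p v) + cmod (p (\<i> *\<^sub>C v))"
      using norm_triangle_ineq[of "p v" "\<i> * p (\<i> *\<^sub>C v)"]
      by (metis norm_mult norm_numeral norm_ii mult_1)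
    then show ?thesis using p[of v] p[of "\<i> *\<^sub>C v"] iv by (simp add: algebra_simps)
  qed
  show ?thesis
  proof (cases "seminorm (T x) = 0 \<or> seminorm x = 0")
    case True
    \<comment> \<open>If the seminorm vanishes identically, \<open>w\<close> may be negative; only
      its product with a seminorm has a known sign.\<close>
    have "w * (seminorm x)\<^sup>2 \<ge> 0" using w[of x] norm_ge_zero order_trans by blast
    then have "0 \<le> 2 * w * seminorm x"
      by (cases "seminorm x = 0") (auto simp: zero_le_mult_iff)
    \<comment> \<open>\<open>T\<close> preserves the null space of the seminorm: otherwise
      \<open>pol\<close> with \<open>v\<close> a small multiple of \<open>T x\<close> has a left
      side linear in \<open>t\<close> and a right side quadratic in \<open>t\<close>.\<close>
    moreover have "seminorm (T x) = 0" if "seminorm x = 0"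
    proof (rule ccontr)
      let ?b = "seminorm (T x)"
      assume b: "?b \<noteq> 0"
      then have b2: "?b\<^sup>2 > 0" by simp
      have 1: "t * ?b\<^sup>2 \<le> w * t\<^sup>2 * ?b\<^sup>2" if "t > 0" for t
        using pol[of x "complex_of_real t *\<^sub>C T x"] \<open>seminorm x = 0\<close> that
        by (simp add: seminorm_scaleC scaleC_right norm_mult self_eq power_mult_distrib mult_ac norm_power)
      have 2: "1 \<le> w * t" if "t > 0" for t
      proof -
        have "(t * ?b\<^sup>2) * 1 \<le> (t * ?b\<^sup>2) * (w * t)"
          using 1[OF that] by (simp add: power2_eq_square mult_ac)
        then show ?thesis using that b2 by (simp add: mult_le_cancel_left_pos)
      qed
      have "w \<ge> 1" using 2[of 1] by simp
      with 2[of "1 / (2 * w)"] show False by simp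
    qed
    ultimately show ?thesis using True by auto
  next
    case False
    let ?a = "seminorm x" and ?b = "seminorm (T x)"
    have pos: "?a > 0" "?b > 0" using False by (simp_all add: less_le)
    have "cmod (h (T x) (complex_of_real (?a / ?b) *\<^sub>C T x)) = ?a * ?b"
      using pos by (simp add: scaleC_right norm_mult norm_divide self_eq norm_power power2_eq_square)
    with pol[of x "complex_of_real (?a / ?b) *\<^sub>C T x"] have "?a * ?b \<le> ?a * (2 * w * ?a)"
      using pos by (simp add: seminorm_scaleC norm_divide power2_eq_square algebra_simps)
    then show ?thesis using pos by simp
  qed
qed

text \<open>The case \<open>n = 2\<close> of the power inequality \<open>\<omega>(T\<^sup>n) \<le> \<omega>(T)\<^sup>n\<close>, by Pearcy's argument.\<close>

lemma numerical_radius_square: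
  assumes T: "clinear T" and w: "\<And>u. cmod (h (T u) u) \<le> w * (seminorm u)\<^sup>2" and "w > 0"
  shows "cmod (h (T (T x)) x) \<le> w\<^sup>2 * (seminorm x)\<^sup>2"
proof -
  have main: "Re (h (S (S x)) x) \<le> w\<^sup>2 * (seminorm x)\<^sup>2"
    if S: "clinear S" and wS: "\<And>u. cmod (h (S u) u) \<le> w * (seminorm u)\<^sup>2" for S
  proof -
    let ?W = "complex_of_real w"
    note lin = clinear_add[OF S] clinear_scaleC[OF S] clinear_diff[OF S]
    define u where "u = ?W *\<^sub>C x + S x"
    define v where "v = ?W *\<^sub>C x - S x"
    \<comment> \<open>Both (W - S)u and (W + S)v equal (W^2 - S^2)x, and u + v = 2Wx.\<close>
    have "(?W * h u u - h (S u) u) + (?W * h v v + h (S v) v) = 2 * ?W * (?W\<^sup>2 * h x x - h (S (S x)) x)"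
      by (simp add: u_def v_def lin add_left add_right diff_left diff_right scaleC_left scaleC_right
          algebra_simps power2_eq_square)
    then have "Re ((?W * h u u - h (S u) u) + (?W * h v v + h (S v) v))
        = Re (of_real (2 * w) * (of_real (w\<^sup>2) * h x x - h (S (S x)) x))" by simp
    moreover have "Re (complex_of_real r * q) = r * Re q" for r q by simp
    ultimately have "(w * (seminorm u)\<^sup>2 - Re (h (S u) u)) + (w * (seminorm v)\<^sup>2 + Re (h (S v) v))
        = 2 * w * (w\<^sup>2 * (seminorm x)\<^sup>2 - Re (h (S (S x)) x))"
      by (simp only: plus_complex.sel minus_complex.sel Re_self)
    moreover have "Re (h (S u) u) \<le> w * (seminorm u)\<^sup>2"
      using wS[of u] abs_Re_le_cmod[of "h (S u) u"] by linarith
    moreover have "- Re (h (S v) v) \<le> w * (seminorm v)\<^sup>2"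
      using wS[of v] abs_Re_le_cmod[of "h (S v) v"] by linarith
    ultimately have "0 \<le> 2 * w * (w\<^sup>2 * (seminorm x)\<^sup>2 - Re (h (S (S x)) x))" by linarith
    then show ?thesis using \<open>w > 0\<close> by (simp add: zero_le_mult_iff)
  qed
  obtain c where c: "cmod c = 1" "c * h (T (T x)) x = of_real (cmod (h (T (T x)) x))"
    using ex_unimodular_phase .
  \<comment> \<open>Rotating \<open>T\<close> by a square root of the phase \<open>c\<close> rotates
    its square by \<open>c\<close>, which makes the value to be bounded real and
    nonnegative.\<close>
  let ?S = "\<lambda>y. csqrt c *\<^sub>C T y"
  have cs: "cmod (csqrt c) = 1" using c(1) by simp
  have "Re (h (?S (?S x)) x) \<le> w\<^sup>2 * (seminorm x)\<^sup>2"
    using T w cs by (intro main clinear_scaleC_comp) (auto simp: scaleC_left norm_mult)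
  moreover have "h (?S (?S x)) x = (csqrt c)\<^sup>2 * h (T (T x)) x"
    by (simp add: clinear_scaleC[OF T] scaleC_left power2_eq_square)
  ultimately show ?thesis using c(2) by simp
qed

text \<open>Approximate eigenvectors of \<open>T\<close> are approximate eigenvectors of its powers,
  by telescoping. The constant \<open>K\<close> depends neither on the vector nor on the phase of
  the eigenvalue, so it survives a limit along a sequence.\<close>

lemma seminorm_funpow_diff_le:
  assumes T: "clinear T" and N: "\<And>u. seminorm (T u) \<le> N * seminorm u" and "N \<ge> 0"
  shows "\<exists>K. \<forall>\<nu> x. cmod \<nu> = N \<longrightarrow>
    seminorm ((T ^^ k) x - \<nu> ^ k *\<^sub>C x) \<le> K * seminorm (T x - \<nu> *\<^sub>C x)"
proof (induction k)
  case 0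
  have "seminorm 0 = 0" using seminorm_scaleC[of 0 0] by simp
  then show ?case by (intro exI[of _ 0]) simp
next
  case (Suc k)
  then obtain K where K: "\<And>\<nu> x. cmod \<nu> = N \<Longrightarrow>
    seminorm ((T ^^ k) x - \<nu> ^ k *\<^sub>C x) \<le> K * seminorm (T x - \<nu> *\<^sub>C x)" by blast
  have "seminorm ((T ^^ Suc k) x - \<nu> ^ Suc k *\<^sub>C x) \<le> (N * K + N ^ k) * seminorm (T x - \<nu> *\<^sub>C x)"
    if "cmod \<nu> = N" for \<nu> x
  proof -
    have sd: "c *\<^sub>C (a - b) = c *\<^sub>C a - c *\<^sub>C b" for c and a b :: 'a
      by (metis add_diff_cancel diff_add_cancel scaleC_add_right)
    have "(T ^^ Suc k) x - \<nu> ^ Suc k *\<^sub>C x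
        = T ((T ^^ k) x - \<nu> ^ k *\<^sub>C x) + \<nu> ^ k *\<^sub>C (T x - \<nu> *\<^sub>C x)"
      by (simp add: clinear_diff[OF T] clinear_scaleC[OF T] sd scaleC_scaleC mult.commute)
    also have "seminorm \<dots> \<le> N * seminorm ((T ^^ k) x - \<nu> ^ k *\<^sub>C x) + N ^ k * seminorm (T x - \<nu> *\<^sub>C x)"
      using seminorm_triangle N that
      by (smt (verit) seminorm_scaleC norm_power)
    also have "\<dots> \<le> N * (K * seminorm (T x - \<nu> *\<^sub>C x)) + N ^ k * seminorm (T x - \<nu> *\<^sub>C x)"
      using K[OF that] \<open>N \<ge> 0\<close> by (intro add_right_mono mult_left_mono)
    finally show ?thesis by (simp add: algebra_simps)
  qed
  then show ?case by blast
qed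

end

section \<open>The form of a positive operator, the Riesz representation and the adjoint\<close>

lemma positive_form_A_inner:
  assumes "bounded_clinear A" and "op_positive A"
  shows "positive_form (A_inner A)"
proof
  note lin = clinear_add[OF bounded_clinear_imp_clinear[OF assms(1)]]
    clinear_scaleC[OF bounded_clinear_imp_clinear[OF assms(1)]]
  show "A_inner A (x + y) z = A_inner A x z + A_inner A y z" for x y z
    by (simp add: A_inner_def lin cinner_add_left)
  show "A_inner A (c *\<^sub>C x) y = c * A_inner A x y" for c x y
    by (simp add: A_inner_def lin cinner_scaleC_left)
  show "A_inner A x (y + z) = A_inner A x y + A_inner A x z" for x y z
    by (simp add: A_inner_def cinner_add_right)
  show "A_inner A x (c *\<^sub>C y) = cnj c * A_inner A x y" for c x y
    by (simp add: A_inner_def cinner_scaleC_right)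
  have zero: "cinner 0 x = 0" for x :: 'a
    using cinner_scaleC_left[of 0 x x] by simp
  have "0 \<le> A_inner A x x" for x
    using assms(2) by (simp add: op_positive_def op_ge_def A_inner_def zero)
  then show "0 \<le> Re (A_inner A x x)" "Im (A_inner A x x) = 0" for x
    by (simp_all add: less_eq_complex_def)
qed

text \<open>The point \<open>u\<close> of least norm on the closed hyperplane where \<open>f\<close>
  is 1 is orthogonal to the kernel of \<open>f\<close>, and \<open>x - f x *\<^sub>R u\<close> lies
  in that kernel.\<close>

lemma Riesz_representation_real:
  fixes f :: "'a::{real_inner, complete_space} \<Rightarrow> real"
  assumes f: "bounded_linear f"
  obtains z where "\<And>x. f x = inner x z"
proof (cases "\<forall>x. f x = 0")
  case True
  then show thesis by (intro that[of 0]) simp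
next
  case False
  interpret bounded_linear f by fact
  from False obtain v where v: "f v \<noteq> 0" by blast
  define C where "C = {x. f x = 1}"
  have "(1 / f v) *\<^sub>R v \<in> C" using v by (simp add: C_def scaleR)
  then have ne: "norm ` C \<noteq> {}" by blast
  have bd: "bdd_below (norm ` C)" by (auto intro: bdd_belowI[of _ 0])
  define d where "d = Inf (norm ` C)"
  have dle: "d \<le> norm x" if "x \<in> C" for x
    unfolding d_def using bd that by (simp add: cInf_lower)
  have d0: "d \<ge> 0" unfolding d_def using ne by (intro cInf_greatest) auto
  have "d \<in> closure (norm ` C)"
    unfolding d_def using ne bd by (rule closure_contains_Inf)
  then obtain r where r: "\<And>n. r n \<in> norm ` C" "r \<longlonglongrightarrow> d"
    unfolding closure_sequential by blast
  then have "\<forall>n. \<exists>x. x \<in> C \<and> r n = norm x" by auto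
  then obtain X where X: "\<And>n. X n \<in> C" "\<And>n. r n = norm (X n)" by metis
  \<comment> \<open>Parallelogram law: the midpoint stays in \<open>C\<close>, so its norm is at
    least \<open>d\<close>. Minimizing sequences are therefore Cauchy.\<close>
  have par: "(norm (x - y))\<^sup>2 \<le> 2 * ((norm x)\<^sup>2 - d\<^sup>2) + 2 * ((norm y)\<^sup>2 - d\<^sup>2)"
    if "x \<in> C" "y \<in> C" for x y
  proof -
    have "(1/2) *\<^sub>R (x + y) \<in> C" using that by (simp add: C_def scaleR add)
    from dle[OF this] have "(2 * d)\<^sup>2 \<le> (norm (x + y))\<^sup>2"
      using d0 by (intro power_mono) auto
    then show ?thesis
      by (simp add: power2_norm_eq_inner algebra_simps inner_commute power_mult_distrib)
  qed
  have "Cauchy X"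
  proof (rule metric_CauchyI)
    fix e :: real assume "e > 0"
    have "(\<lambda>n. (r n)\<^sup>2 - d\<^sup>2) \<longlonglongrightarrow> d\<^sup>2 - d\<^sup>2"
      by (intro tendsto_intros r(2))
    then have "eventually (\<lambda>n. (r n)\<^sup>2 - d\<^sup>2 < e\<^sup>2 / 4) sequentially"
      using \<open>e > 0\<close> by (intro order_tendstoD(2)) auto
    then obtain M where M: "\<And>n. n \<ge> M \<Longrightarrow> (r n)\<^sup>2 - d\<^sup>2 < e\<^sup>2 / 4"
      unfolding eventually_sequentially by blast
    have "dist (X m) (X n) < e" if "m \<ge> M" "n \<ge> M" for m n
    proof -
      have "(norm (X m - X n))\<^sup>2 < e\<^sup>2"
        using par[OF X(1)[of m] X(1)[of n]] M[OF that(1)] M[OF that(2)]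
        by (simp add: X(2))
      then show ?thesis
        using \<open>e > 0\<close> by (simp add: dist_norm power_less_imp_less_base)
    qed
    then show "\<exists>M. \<forall>m\<ge>M. \<forall>n\<ge>M. dist (X m) (X n) < e" by blast
  qed
  then obtain u where u: "X \<longlonglongrightarrow> u"
    using Cauchy_convergent_iff convergent_def by blast
  have "(\<lambda>n. f (X n)) \<longlonglongrightarrow> f u" by (intro tendsto u)
  moreover have "(\<lambda>n. f (X n)) = (\<lambda>n. 1)" using X(1) by (simp add: C_def)
  ultimately have fu: "f u = 1" using LIMSEQ_unique tendsto_const by metis
  have "(\<lambda>n. norm (X n)) \<longlonglongrightarrow> norm u" by (intro tendsto_norm u)
  moreover have "(\<lambda>n. norm (X n)) = r" using X(2) by auto
  ultimately have nu: "norm u = d" using r(2) LIMSEQ_unique by blast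
  have orth: "inner y u = 0" if "f y = 0" for y
  proof (rule ccontr)
    assume n0: "inner y u \<noteq> 0"
    \<comment> \<open>This \<open>t\<close> minimizes the norm of \<open>u + t *\<^sub>R y\<close>;
      a nonzero inner product would push the norm below \<open>d\<close>.\<close>
    define t where "t = - inner y u / inner y y"
    have "y \<noteq> 0" using n0 by auto
    then have yy: "inner y y > 0" by simp
    have "u + t *\<^sub>R y \<in> C" using fu that by (simp add: C_def add scaleR)
    from dle[OF this] have "d\<^sup>2 \<le> (norm (u + t *\<^sub>R y))\<^sup>2"
      using d0 by (intro power_mono) auto
    also have "\<dots> = d\<^sup>2 + 2 * t * inner y u + t\<^sup>2 * inner y y"
      unfolding nu[symmetric] power2_norm_eq_inner
      by (simp add: algebra_simps inner_commute power2_eq_square)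
    also have "\<dots> = d\<^sup>2 - (inner y u)\<^sup>2 / inner y y"
      using yy by (simp add: t_def field_simps power2_eq_square)
    finally show False using n0 yy by (simp add: field_simps)
  qed
  have uu: "inner u u \<noteq> 0" using fu zero by auto
  have "f x = inner x ((1 / inner u u) *\<^sub>R u)" for x
    using orth[of "x - f x *\<^sub>R u"] fu uu by (simp add: diff scaleR algebra_simps)
  then show thesis by (rule that)
qed

text \<open>Justifies the definite description in \<open>cadjoint\<close>. The real Riesz theorem
  supplies \<open>S\<close> for the real parts; replacing \<open>x\<close> by
  \<open>- \<i> *\<^sub>C x\<close> transfers the identity to the imaginary parts.\<close>

lemma cinner_cadjoint:
  fixes T :: "'a::chilbert_space \<Rightarrow> 'a"
  assumes "bounded_clinear T"
  shows "cinner (T x) y = cinner x (cadjoint T y)"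
proof -
  have T: "bounded_linear T" using assms by (simp add: bounded_clinear_def)
  have "\<exists>z. \<forall>x. inner (T x) y = inner x z" for y
  proof -
    have "bounded_linear (\<lambda>x. inner (T x) y)"
      by (rule bounded_linear_compose[OF bounded_linear_inner_left T])
    from Riesz_representation_real[OF this] show ?thesis by metis
  qed
  then obtain S where S: "\<And>x y. inner (T x) y = inner x (S y)" by metis
  have "cinner (T x) y = cinner x (S y)" for x y
  proof (rule complex_eqI)
    show "Re (cinner (T x) y) = Re (cinner x (S y))"
      using S[of x y] by (simp add: inner_eq_Re_cinner)
    show "Im (cinner (T x) y) = Im (cinner x (S y))"
      using S[of "- \<i> *\<^sub>C x" y] clinear_scaleC[OF bounded_clinear_imp_clinear[OF assms], of "- \<i>" x]
      by (simp add: inner_eq_Re_cinner cinner_scaleC_left)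
  qed
  then have "\<forall>x y. cinner (T x) y = cinner x (S y)" by blast
  then have "\<forall>x y. cinner (T x) y = cinner x ((THE S. \<forall>x y. cinner (T x) y = cinner x (S y)) y)"
  proof (rule theI[where P = "\<lambda>S. \<forall>x y. cinner (T x) y = cinner x (S y)"])
    fix R assume R: "\<forall>x y. cinner (T x) y = cinner x (R y)"
    show "R = S"
    proof
      fix y
      have "inner x (R y) = inner x (S y)" for x
        using R S[of x y] by (simp add: inner_eq_Re_cinner)
      then show "R y = S y" by (metis vector_eq_rdot inner_commute)
    qed
  qed
  then show ?thesis unfolding cadjoint_def by blast
qed

section \<open>Unit vectors and operator seminorms for a positive operator\<close>

locale positive_operator =
  fixes A :: "'a::complex_inner \<Rightarrow> 'a"
  assumes A_linear: "bounded_clinear A" and A_positive: "op_positive A" and A_nonzero: "A \<noteq> (\<lambda>x. 0)"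
begin

sublocale positive_form "A_inner A"
  rewrites "positive_form.seminorm (A_inner A) = A_norm A"
proof -
  show f: "positive_form (A_inner A)"
    using A_linear A_positive by (rule positive_form_A_inner)
  show "positive_form.seminorm (A_inner A) = A_norm A"
    by (rule ext) (simp add: positive_form.seminorm_def[OF f] A_norm_def)
qed

text \<open>The form at \<open>x\<close> and \<open>A x\<close> is the squared norm of
  \<open>A x\<close>, so by Cauchy-Schwarz \<open>A x\<close> can be nonzero only if
  \<open>x\<close> has nonzero seminorm. Hence the suprema range over nonempty sets.\<close>

lemma ex_unit_vector: "\<exists>x. A_norm A x = 1"
proof -
  obtain x where "A x \<noteq> 0" using A_nonzero by blast
  then have "cinner (A x) (A x) \<noteq> 0" by (simp add: cinner_self)
  then have "A_norm A x \<noteq> 0"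
    using Cauchy_Schwarz[of x "A x"] by (auto simp: A_inner_def)
  then have "A_norm A (complex_of_real (1 / A_norm A x) *\<^sub>C x) = 1"
    by (simp only: seminorm_scaleC) (simp add: norm_divide)
  then show ?thesis by blast
qed

lemma unit_vector_scaling:
  assumes "A_norm A x \<noteq> 0"
  obtains y where "A_norm A y = 1" "x = complex_of_real (A_norm A x) *\<^sub>C y"
  using assms
  by (intro that[of "complex_of_real (1 / A_norm A x) *\<^sub>C x"])
     (simp_all only: seminorm_scaleC scaleC_scaleC, simp_all add: norm_divide)

lemma A_opnorm_least:
  "(\<And>x. A_norm A x = 1 \<Longrightarrow> A_norm A (S x) \<le> c) \<Longrightarrow> A_opnorm A S \<le> c"
  unfolding A_opnorm_def using ex_unit_vector by (intro cSup_least) auto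

lemma A_numerical_radius_least:
  "(\<And>x. A_norm A x = 1 \<Longrightarrow> cmod (A_inner A (S x) x) \<le> c) \<Longrightarrow> A_numerical_radius A S \<le> c"
  unfolding A_numerical_radius_def using ex_unit_vector by (intro cSup_least) auto

lemma le_A_opnorm_unit:
  assumes "\<And>x. A_norm A (S x) \<le> c * A_norm A x" and "A_norm A x = 1"
  shows "A_norm A (S x) \<le> A_opnorm A S"
  unfolding A_opnorm_def using assms
  by (intro cSup_upper) (auto intro!: bdd_aboveI[of _ c], metis mult_1_right)

lemma le_A_opnorm:
  assumes S: "clinear S" and c: "\<And>x. A_norm A (S x) \<le> c * A_norm A x"
  shows "A_norm A (S x) \<le> A_opnorm A S * A_norm A x"
proof (cases "A_norm A x = 0")
  case True
  with c[of x] show ?thesis by simp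
next
  case False
  then obtain y where y: "A_norm A y = 1" "x = complex_of_real (A_norm A x) *\<^sub>C y"
    by (rule unit_vector_scaling)
  have "A_norm A (S x) = A_norm A x * A_norm A (S y)"
    by (subst y(2)) (simp add: clinear_scaleC[OF S] seminorm_scaleC)
  also have "\<dots> \<le> A_norm A x * A_opnorm A S"
    using le_A_opnorm_unit[OF c y(1)] by (intro mult_left_mono) auto
  finally show ?thesis by (simp add: mult.commute)
qed

lemma A_opnorm_id: "A_opnorm A id = 1"
proof -
  have "{A_norm A (id x) | x. A_norm A x = 1} = {1}"
    using ex_unit_vector by auto
  then show ?thesis by (simp add: A_opnorm_def)
qed

end

section \<open>Equality of numerical radius and operator seminorm for an A-bounded operator\<close>

locale A_bounded_operator = positive_operator +
  fixes T assumes T_bounded: "A_bounded A T"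
begin

abbreviation "N \<equiv> A_opnorm A T"
abbreviation "w \<equiv> A_numerical_radius A T"

lemma T_linear: "clinear T"
  using T_bounded by (simp add: A_bounded_def bounded_clinear_imp_clinear)

lemma T_le: "A_norm A (T x) \<le> N * A_norm A x"
  using T_bounded le_A_opnorm[OF T_linear] by (auto simp: A_bounded_def)

lemma T_le_unit: "A_norm A x = 1 \<Longrightarrow> A_norm A (T x) \<le> N"
  using T_le[of x] by simp

lemma N_nonneg: "N \<ge> 0"
  using ex_unit_vector T_le_unit seminorm_nonneg order_trans by metis

lemma form_le_norm: "A_norm A x = 1 \<Longrightarrow> cmod (A_inner A (T x) x) \<le> A_norm A (T x)"
  using Cauchy_Schwarz[of "T x" x] by simp

lemma w_upper_unit: "A_norm A x = 1 \<Longrightarrow> cmod (A_inner A (T x) x) \<le> w"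
  unfolding A_numerical_radius_def
  by (rule cSup_upper)
     (auto intro!: bdd_aboveI[of _ N] intro: order_trans[OF form_le_norm T_le_unit])

lemma w_le_N: "w \<le> N"
  using form_le_norm T_le_unit by (intro A_numerical_radius_least) (meson order_trans)

lemma w_nonneg: "w \<ge> 0"
  using ex_unit_vector w_upper_unit norm_ge_zero order_trans by metis

lemma w_upper: "cmod (A_inner A (T x) x) \<le> w * (A_norm A x)\<^sup>2"
proof (cases "A_norm A x = 0")
  case True
  with Cauchy_Schwarz[of "T x" x] show ?thesis by simp
next
  case False
  then obtain y where y: "A_norm A y = 1" "x = complex_of_real (A_norm A x) *\<^sub>C y"
    by (rule unit_vector_scaling)
  have "cmod (A_inner A (T x) x) = (A_norm A x)\<^sup>2 * cmod (A_inner A (T y) y)"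
    by (subst (1 2) y(2))
       (simp add: clinear_scaleC[OF T_linear] scaleC_left scaleC_right norm_mult power2_eq_square)
  also have "\<dots> \<le> (A_norm A x)\<^sup>2 * w"
    using w_upper_unit[OF y(1)] by (intro mult_left_mono) auto
  finally show ?thesis by (simp add: mult.commute)
qed

lemma numerical_radius_seq:
  obtains X where "\<And>n. A_norm A (X n) = 1"
    "(\<lambda>n. cmod (A_inner A (T (X n)) (X n))) \<longlonglongrightarrow> w"
  using ex_seq_tendsto_Sup[of "\<lambda>x. A_norm A x = 1" "\<lambda>x. cmod (A_inner A (T x) x)" w,
      OF ex_unit_vector w_upper_unit, folded A_numerical_radius_def]
  by blast

text \<open>If \<open>w = N\<close>, then Cauchy-Schwarz makes one maximizing sequence for
  \<open>w\<close> drive both terms to their bounds. Conversely, equality forces both terms to their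
  bounds along a common sequence, and \<open>numerical_radius_gap_bound\<close> passes to the
  limit.\<close>

lemma Davis_Wielandt_iff:
  "A_Davis_Wielandt_radius A T = sqrt (w\<^sup>2 + N ^ 4) \<longleftrightarrow> w = N"
proof -
  define f where "f = (\<lambda>x. sqrt ((cmod (A_inner A (T x) x))\<^sup>2 + A_norm A (T x) ^ 4))"
  let ?d = "A_Davis_Wielandt_radius A T"
  have d: "?d = Sup {f x | x. A_norm A x = 1}"
    by (simp add: A_Davis_Wielandt_radius_def f_def)
  have f_le: "f x \<le> sqrt (w\<^sup>2 + N ^ 4)" if "A_norm A x = 1" for x
    unfolding f_def using w_upper_unit[OF that] T_le_unit[OF that]
    by (intro real_sqrt_le_mono add_mono power_mono) auto
  have f_le_d: "f x \<le> ?d" if "A_norm A x = 1" for x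
    unfolding d using that f_le by (intro cSup_upper) (auto intro!: bdd_aboveI[of _ "sqrt (w\<^sup>2 + N ^ 4)"])
  show ?thesis
  proof
    assume wN: "w = N"
    obtain X where X: "\<And>n. A_norm A (X n) = 1"
      "(\<lambda>n. cmod (A_inner A (T (X n)) (X n))) \<longlonglongrightarrow> w"
      using numerical_radius_seq by blast
    define a where "a = (\<lambda>n. cmod (A_inner A (T (X n)) (X n)))"
    have "(\<lambda>n. sqrt ((a n)\<^sup>2 + a n ^ 4)) \<longlonglongrightarrow> sqrt (w\<^sup>2 + w ^ 4)"
      using X(2) unfolding a_def by (intro tendsto_intros)
    moreover have "sqrt ((a n)\<^sup>2 + a n ^ 4) \<le> ?d" for n
    proof -
      have "sqrt ((a n)\<^sup>2 + a n ^ 4) \<le> f (X n)"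
        unfolding f_def a_def using form_le_norm[OF X(1)]
        by (intro real_sqrt_le_mono add_mono power_mono) auto
      with f_le_d[OF X(1)] show ?thesis by (meson order_trans)
    qed
    ultimately have "sqrt (w\<^sup>2 + w ^ 4) \<le> ?d"
      by (intro LIMSEQ_le_const2) auto
    moreover have "?d \<le> sqrt (w\<^sup>2 + N ^ 4)"
      unfolding d using ex_unit_vector f_le by (intro cSup_least) auto
    ultimately show "?d = sqrt (w\<^sup>2 + N ^ 4)" using wN by simp
  next
    assume eq: "?d = sqrt (w\<^sup>2 + N ^ 4)"
    obtain X where X: "\<And>n. A_norm A (X n) = 1" and "(\<lambda>n. f (X n)) \<longlonglongrightarrow> ?d"
      using ex_seq_tendsto_Sup[of "\<lambda>x. A_norm A x = 1" f, OF ex_unit_vector f_le, folded d]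
      by blast
    then have f2: "(\<lambda>n. (f (X n))\<^sup>2) \<longlonglongrightarrow> w\<^sup>2 + N ^ 4"
      using tendsto_power[of "\<lambda>n. f (X n)" ?d sequentially 2] N_nonneg by (simp add: eq)
    define a where "a = (\<lambda>n. cmod (A_inner A (T (X n)) (X n)))"
    define b where "b = (\<lambda>n. A_norm A (T (X n)))"
    have a0: "a n \<ge> 0" and b0: "b n \<ge> 0" and a_le: "a n \<le> w" and b_le: "b n \<le> N" for n
      using w_upper_unit[OF X] T_le_unit[OF X] by (auto simp: a_def b_def)
    have a2: "(a n)\<^sup>2 \<le> w\<^sup>2" and b4: "b n ^ 4 \<le> N ^ 4" for n
      using a0 b0 a_le b_le by (simp_all add: power_mono)
    have f2n: "(f (X n))\<^sup>2 = (a n)\<^sup>2 + b n ^ 4" for n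
      by (simp add: f_def a_def b_def)
    \<comment> \<open>As the sum tends to the sum of the separate upper bounds, each term is
      squeezed to its own bound.\<close>
    have "(\<lambda>n. (a n)\<^sup>2) \<longlonglongrightarrow> w\<^sup>2"
    proof (rule tendsto_sandwich)
      show "(\<lambda>n. (f (X n))\<^sup>2 - N ^ 4) \<longlonglongrightarrow> w\<^sup>2"
        using tendsto_diff[OF f2 tendsto_const[of "N ^ 4"]] by simp
      show "(\<lambda>n. w\<^sup>2) \<longlonglongrightarrow> w\<^sup>2" by simp
    qed (use a2 b4 in \<open>auto simp: f2n\<close>)
    then have "(\<lambda>n. sqrt ((a n)\<^sup>2)) \<longlonglongrightarrow> sqrt (w\<^sup>2)" by (rule tendsto_real_sqrt)
    then have a_lim: "a \<longlonglongrightarrow> w" using a0 w_nonneg by simp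
    have "(\<lambda>n. b n ^ 4) \<longlonglongrightarrow> N ^ 4"
    proof (rule tendsto_sandwich)
      show "(\<lambda>n. (f (X n))\<^sup>2 - w\<^sup>2) \<longlonglongrightarrow> N ^ 4"
        using tendsto_diff[OF f2 tendsto_const[of "w\<^sup>2"]] by simp
      show "(\<lambda>n. N ^ 4) \<longlonglongrightarrow> N ^ 4" by simp
    qed (use a2 b4 in \<open>auto simp: f2n\<close>)
    then have "(\<lambda>n. sqrt (b n ^ 4)) \<longlonglongrightarrow> sqrt (N ^ 4)" by (rule tendsto_real_sqrt)
    moreover have "sqrt (t ^ 4) = t\<^sup>2" for t :: real
      by (rule real_sqrt_unique) (simp_all flip: power_mult)
    ultimately have b_lim: "(\<lambda>n. (b n)\<^sup>2) \<longlonglongrightarrow> N\<^sup>2" by simp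
    have bound: "(N - w) * (N\<^sup>2 - w\<^sup>2)
      \<le> N * sqrt (16 * N ^ 3 * (2 * w - 2 * a n)) + sqrt (4 * N ^ 4 * (N\<^sup>2 - (b n)\<^sup>2))" for n
    proof -
      \<comment> \<open>The gap bound asks for a real numerical value; a rotation of
        \<open>T\<close> achieves this and changes neither seminorms nor moduli.\<close>
      obtain c where c: "cmod c = 1" "c * A_inner A (T (X n)) (X n) = of_real (a n)"
        unfolding a_def using ex_unimodular_phase .
      have "(N - w) * (N\<^sup>2 - w\<^sup>2)
        \<le> N * sqrt (16 * N ^ 3 * (2 * w - 2 * a n))
          + sqrt (4 * N ^ 4 * (N\<^sup>2 - (A_norm A (c *\<^sub>C T (X n)))\<^sup>2))"
        using clinear_scaleC_comp[OF T_linear] w_upper T_le w_nonneg w_le_N X c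
        by (intro numerical_radius_gap_bound[of "\<lambda>x. c *\<^sub>C T x"])
           (simp_all add: scaleC_left norm_mult seminorm_scaleC)
      then show ?thesis using c(1) by (simp add: b_def seminorm_scaleC)
    qed
    have "(\<lambda>n. N * sqrt (16 * N ^ 3 * (2 * w - 2 * a n)) + sqrt (4 * N ^ 4 * (N\<^sup>2 - (b n)\<^sup>2)))
      \<longlonglongrightarrow> N * sqrt (16 * N ^ 3 * (2 * w - 2 * w)) + sqrt (4 * N ^ 4 * (N\<^sup>2 - N\<^sup>2))"
      by (intro tendsto_intros a_lim b_lim)
    then have "(N - w) * (N\<^sup>2 - w\<^sup>2) \<le> 0"
      using bound by (intro LIMSEQ_le_const[where a = "(N - w) * (N\<^sup>2 - w\<^sup>2)"]) auto
    then have "(N - w)\<^sup>2 * (N + w) \<le> 0"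
      by (simp add: power2_eq_square algebra_simps)
    moreover have "(N - w)\<^sup>2 * (N + w) > 0" if "w < N"
      using that w_nonneg by (intro mult_pos_pos) auto
    ultimately show "w = N" using w_le_N by (meson less_le not_less)
  qed
qed

text \<open>By \<open>Psq\<close>, parallelism gives (N + 1)^2 <= N^2 + 1 + 2w, that is, N <= w. For
  the converse, phases that align \<open>T x\<close> with \<open>x\<close> along a maximizing
  sequence are replaced by a single one through compactness.\<close>

lemma norm_parallel_iff: "A_norm_parallel A T id \<longleftrightarrow> w = N"
proof -
  define P where "P = (\<lambda>l x. T x + l *\<^sub>C x)"
  define p where "p = (\<lambda>l. A_opnorm A (P l))"
  have Pbd: "A_norm A (P l x) \<le> (N + cmod l) * A_norm A x" for l x
    using seminorm_triangle[of "T x" "l *\<^sub>C x"] T_le[of x]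
    by (simp add: P_def seminorm_scaleC algebra_simps)
  have Pp: "A_norm A (P l x) \<le> p l" if "A_norm A x = 1" for l x
    unfolding p_def using Pbd that by (rule le_A_opnorm_unit)
  have Psq: "(A_norm A (P l x))\<^sup>2 = (A_norm A (T x))\<^sup>2 + 1 + 2 * Re (cnj l * A_inner A (T x) x)"
    if "cmod l = 1" "A_norm A x = 1" for l x
    using that by (simp only: P_def seminorm_add_sq) (simp add: seminorm_scaleC scaleC_right)
  have par: "A_norm_parallel A T id \<longleftrightarrow> (\<exists>l. cmod l = 1 \<and> p l = N + 1)"
    by (simp add: A_norm_parallel_def A_opnorm_id p_def P_def)
  show ?thesis
    unfolding par
  proof
    assume "\<exists>l. cmod l = 1 \<and> p l = N + 1"
    then obtain l where l: "cmod l = 1" "p l = N + 1" by blast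
    have "p l \<le> sqrt (N\<^sup>2 + 1 + 2 * w)"
      unfolding p_def
    proof (rule A_opnorm_least, rule real_le_rsqrt)
      fix x assume x: "A_norm A x = 1"
      have "Re (cnj l * A_inner A (T x) x) \<le> w"
        using complex_Re_le_cmod[of "cnj l * A_inner A (T x) x"] w_upper_unit[OF x] l(1)
        by (simp add: norm_mult)
      moreover have "(A_norm A (T x))\<^sup>2 \<le> N\<^sup>2"
        using T_le_unit[OF x] by (intro power_mono) auto
      ultimately show "(A_norm A (P l x))\<^sup>2 \<le> N\<^sup>2 + 1 + 2 * w"
        unfolding Psq[OF l(1) x] by linarith
    qed
    then have "(N + 1)\<^sup>2 \<le> (sqrt (N\<^sup>2 + 1 + 2 * w))\<^sup>2"
      unfolding l(2) using N_nonneg by (intro power_mono) auto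
    then have "N \<le> w" using w_nonneg by (simp add: power2_sum)
    then show "w = N" using w_le_N by simp
  next
    assume wN: "w = N"
    \<comment> \<open>The aligning phases vary with \<open>n\<close>. Continuity of \<open>p\<close>
      on the compact unit circle supplies one \<open>l\<close> that does at least as well as all of
      them.\<close>
    have lip: "p l \<le> p m + cmod (l - m)" for l m
    proof -
      have "A_opnorm A (P l) \<le> p m + cmod (l - m)"
      proof (rule A_opnorm_least)
        fix x assume x: "A_norm A x = 1"
        have "P l x = P m x + (l - m) *\<^sub>C x"
          using scaleC_add_left[of m "l - m" x] by (simp add: P_def)
        then show "A_norm A (P l x) \<le> p m + cmod (l - m)"
          using seminorm_triangle[of "P m x" "(l - m) *\<^sub>C x"] Pp[OF x, of m] x
          by (simp add: seminorm_scaleC)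
      qed
      then show ?thesis by (simp add: p_def)
    qed
    have "1-lipschitz_on (sphere 0 1) p"
    proof (rule lipschitz_onI)
      show "dist (p l) (p m) \<le> 1 * dist l m" for l m
        using lip[of l m] lip[of m l] by (simp add: dist_norm norm_minus_commute abs_le_iff)
    qed simp
    then have "continuous_on (sphere 0 1) p" by (rule lipschitz_on_continuous_on)
    moreover have "(1::complex) \<in> sphere 0 1" by simp
    then have "sphere (0::complex) 1 \<noteq> {}" by blast
    ultimately obtain l where l: "l \<in> sphere 0 1" and max: "\<And>m. m \<in> sphere 0 1 \<Longrightarrow> p m \<le> p l"
      using continuous_attains_sup[OF compact_sphere] by metis
    obtain X where X: "\<And>n. A_norm A (X n) = 1"
      "(\<lambda>n. cmod (A_inner A (T (X n)) (X n))) \<longlonglongrightarrow> w"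
      using numerical_radius_seq by blast
    have "cmod (A_inner A (T (X n)) (X n)) + 1 \<le> p l" for n
    proof -
      obtain c where c: "cmod c = 1"
        "c * A_inner A (T (X n)) (X n) = of_real (cmod (A_inner A (T (X n)) (X n)))"
        using ex_unimodular_phase .
      have "(cmod (A_inner A (T (X n)) (X n)) + 1)\<^sup>2 \<le> (A_norm A (P (cnj c) (X n)))\<^sup>2"
        using power_mono[OF form_le_norm[OF X(1)[of n]], of 2] c X(1)
        by (subst Psq) (simp_all add: power2_sum)
      then have "cmod (A_inner A (T (X n)) (X n)) + 1 \<le> A_norm A (P (cnj c) (X n))"
        by (rule power2_le_imp_le) simp
      also have "\<dots> \<le> p (cnj c)" using X(1) by (rule Pp)
      also have "\<dots> \<le> p l" using c by (intro max) simp
      finally show ?thesis .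
    qed
    moreover have "(\<lambda>n. cmod (A_inner A (T (X n)) (X n)) + 1) \<longlonglongrightarrow> w + 1"
      by (intro tendsto_intros X(2))
    ultimately have "w + 1 \<le> p l" by (intro LIMSEQ_le_const2) auto
    moreover have "p l \<le> N + 1"
      unfolding p_def using Pbd[of l] l by (intro A_opnorm_least) (metis dist_0_norm mem_sphere mult_1_right)
    ultimately show "\<exists>l. cmod l = 1 \<and> p l = N + 1"
      using l wN by (intro exI[of _ l]) auto
  qed
qed

lemma funpow_le: "A_norm A ((T ^^ k) x) \<le> N ^ k * A_norm A x"
proof (induction k)
  case (Suc k)
  have "A_norm A ((T ^^ Suc k) x) \<le> N * A_norm A ((T ^^ k) x)" using T_le by simp
  also have "\<dots> \<le> N * (N ^ k * A_norm A x)" using Suc N_nonneg by (intro mult_left_mono) auto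
  finally show ?case by simp
qed simp

text \<open>The term \<open>n = 1\<close> of the infimum is \<open>N\<close> itself, so equality
  holds exactly when no other term is smaller.\<close>

lemma normaloid_iff_powers: "A_normaloid A T \<longleftrightarrow> (\<forall>n\<ge>1. N ^ n \<le> A_opnorm A (T ^^ n))"
proof -
  have bdd: "bdd_below ((\<lambda>n. root n (A_opnorm A (T ^^ n))) ` {1..})"
  proof (rule bdd_belowI2[of _ 0])
    fix n :: nat
    obtain x where x: "A_norm A x = 1" using ex_unit_vector by blast
    have "A_norm A ((T ^^ n) x) \<le> A_opnorm A (T ^^ n)"
      using funpow_le x by (rule le_A_opnorm_unit)
    then have "0 \<le> A_opnorm A (T ^^ n)"
      using seminorm_nonneg order_trans by blast
    then show "0 \<le> root n (A_opnorm A (T ^^ n))" by (cases "n = 0") auto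
  qed
  show ?thesis
    unfolding A_normaloid_def A_spectral_radius_def
  proof (intro iffI allI impI)
    fix n :: nat assume eq: "(INF n\<in>{1..}. root n (A_opnorm A (T ^^ n))) = N" and n: "n \<ge> 1"
    have "N \<le> root n (A_opnorm A (T ^^ n))"
      unfolding eq[symmetric] using bdd n by (intro cINF_lower) auto
    then have "N ^ n \<le> root n (A_opnorm A (T ^^ n)) ^ n"
      using N_nonneg by (intro power_mono)
    moreover have "0 \<le> A_opnorm A (T ^^ n)"
    proof -
      have "0 \<le> root n (A_opnorm A (T ^^ n))"
        using N_nonneg \<open>N \<le> _\<close> by linarith
      then show ?thesis using n by (simp add: real_root_ge_0_iff)
    qed
    ultimately show "N ^ n \<le> A_opnorm A (T ^^ n)" using n by simp
  next
    assume *: "\<forall>n\<ge>1. N ^ n \<le> A_opnorm A (T ^^ n)"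
    show "(INF n\<in>{1..}. root n (A_opnorm A (T ^^ n))) = N"
    proof (rule antisym)
      show "(INF n\<in>{1..}. root n (A_opnorm A (T ^^ n))) \<le> N"
        using cINF_lower[OF bdd, of 1] by simp
      show "N \<le> (INF n\<in>{1..}. root n (A_opnorm A (T ^^ n)))"
      proof (rule cINF_greatest)
        fix n :: nat assume n: "n \<in> {1..}"
        then have "root n (N ^ n) \<le> root n (A_opnorm A (T ^^ n))"
          using * by (intro real_root_le_mono) auto
        then show "N \<le> root n (A_opnorm A (T ^^ n))"
          using n N_nonneg by (simp add: real_root_power_cancel)
      qed simp
    qed
  qed
qed

lemma normaloid_iff: "A_normaloid A T \<longleftrightarrow> w = N"
  unfolding normaloid_iff_powers
proof (intro iffI allI impI)
  fix k :: nat assume wN: "w = N"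
  obtain K where K: "\<And>\<nu> x. cmod \<nu> = N \<Longrightarrow>
      A_norm A ((T ^^ k) x - \<nu> ^ k *\<^sub>C x) \<le> K * A_norm A (T x - \<nu> *\<^sub>C x)"
    using seminorm_funpow_diff_le[OF T_linear T_le N_nonneg, of k] by blast
  obtain X where X: "\<And>n. A_norm A (X n) = 1"
    "(\<lambda>n. cmod (A_inner A (T (X n)) (X n))) \<longlonglongrightarrow> w"
    using numerical_radius_seq by blast
  define a where "a = (\<lambda>n. cmod (A_inner A (T (X n)) (X n)))"
  have "N ^ k - \<bar>K\<bar> * sqrt (2 * N * (N - a n)) \<le> A_opnorm A (T ^^ k)" for n
  proof -
    obtain c where c: "cmod c = 1" "c * A_inner A (T (X n)) (X n) = of_real (a n)"
      unfolding a_def using ex_unimodular_phase .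
    \<comment> \<open>The approximate eigenvalue: its phase turns the cross term into
      \<open>N * a n\<close>, so the squared distance of \<open>T (X n)\<close> from
      \<open>\<nu> *\<^sub>C X n\<close> is at most \<open>2 * N * (N - a n)\<close>.\<close>
    define \<nu> where "\<nu> = of_real N * cnj c"
    have \<nu>: "cmod \<nu> = N" using c N_nonneg by (simp add: \<nu>_def norm_mult)
    have "(A_norm A (T (X n) - \<nu> *\<^sub>C X n))\<^sup>2
        = (A_norm A (T (X n)))\<^sup>2 + N\<^sup>2 - 2 * Re (cnj \<nu> * A_inner A (T (X n)) (X n))"
      using seminorm_add_sq[of "T (X n)" "- (\<nu> *\<^sub>C X n)"] X(1)[of n] \<nu>
      by (simp add: seminorm_minus seminorm_scaleC minus_right scaleC_right)
    also have "cnj \<nu> * A_inner A (T (X n)) (X n) = of_real (N * a n)"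
      using c(2) by (simp add: \<nu>_def mult.assoc)
    also have "(A_norm A (T (X n)))\<^sup>2 + N\<^sup>2 - 2 * Re (complex_of_real (N * a n)) \<le> 2 * N * (N - a n)"
      using power_mono[OF T_le_unit[OF X(1)[of n]], of 2] by (simp add: power2_eq_square algebra_simps)
    finally have d: "A_norm A (T (X n) - \<nu> *\<^sub>C X n) \<le> sqrt (2 * N * (N - a n))"
      by (rule real_le_rsqrt)
    have "N ^ k - A_norm A ((T ^^ k) (X n)) \<le> A_norm A (\<nu> ^ k *\<^sub>C X n - (T ^^ k) (X n))"
      using seminorm_diff_ge[of "\<nu> ^ k *\<^sub>C X n" "(T ^^ k) (X n)"] X(1)[of n] \<nu>
      by (simp add: seminorm_scaleC norm_power)
    also have "\<dots> = A_norm A ((T ^^ k) (X n) - \<nu> ^ k *\<^sub>C X n)"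
      using seminorm_minus by (metis minus_diff_eq)
    also have "\<dots> \<le> K * A_norm A (T (X n) - \<nu> *\<^sub>C X n)" by (rule K[OF \<nu>])
    also have "\<dots> \<le> \<bar>K\<bar> * sqrt (2 * N * (N - a n))"
      using d by (intro mult_mono) auto
    finally show ?thesis
      using le_A_opnorm_unit[OF funpow_le X(1)[of n], of k] by linarith
  qed
  moreover have "(\<lambda>n. N ^ k - \<bar>K\<bar> * sqrt (2 * N * (N - a n)))
      \<longlonglongrightarrow> N ^ k - \<bar>K\<bar> * sqrt (2 * N * (N - w))"
    using X(2) unfolding a_def by (intro tendsto_intros)
  ultimately have "N ^ k - \<bar>K\<bar> * sqrt (2 * N * (N - w)) \<le> A_opnorm A (T ^^ k)"
    by (intro LIMSEQ_le_const2) auto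
  then show "N ^ k \<le> A_opnorm A (T ^^ k)" using wN by simp
next
  assume pow: "\<forall>n\<ge>1. N ^ n \<le> A_opnorm A (T ^^ n)"
  show "w = N"
  proof (rule ccontr)
    assume "w \<noteq> N"
    then have "w < N" using w_le_N by simp
    have "w > 0"
    proof (rule ccontr)
      assume "\<not> w > 0"
      then have "w = 0" using w_nonneg by simp
      then have "N \<le> 0"
        using seminorm_le_2_numerical_radius[OF T_linear w_upper]
        by (intro A_opnorm_least) (metis mult_zero_left mult_zero_right)
      with \<open>w < N\<close> \<open>w = 0\<close> show False by simp
    qed
    \<comment> \<open>Iterated squaring confines the power inequality to exponents that are powers
      of two; these suffice, since the bound is used only along a subsequence.\<close>
    have num: "cmod (A_inner A ((T ^^ (2 ^ k)) u) u) \<le> w ^ (2 ^ k) * (A_norm A u)\<^sup>2" for k u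
    proof (induction k arbitrary: u)
      case 0
      then show ?case using w_upper by simp
    next
      case (Suc k)
      have "cmod (A_inner A ((T ^^ (2 ^ k)) ((T ^^ (2 ^ k)) u)) u) \<le> (w ^ (2 ^ k))\<^sup>2 * (A_norm A u)\<^sup>2"
        using Suc \<open>w > 0\<close> by (intro numerical_radius_square clinear_funpow T_linear) auto
      then show ?case
        by (simp add: mult_2 funpow_add power_add power2_eq_square)
    qed
    \<comment> \<open>The factor 2 stays fixed while the exponent grows, so a ratio
      \<open>N / w\<close> above 1 is impossible.\<close>
    have "N ^ (2 ^ k) \<le> 2 * w ^ (2 ^ k)" for k
    proof -
      have "N ^ (2 ^ k) \<le> A_opnorm A (T ^^ (2 ^ k))" using pow by simp
      also have "\<dots> \<le> 2 * w ^ (2 ^ k)"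
        using seminorm_le_2_numerical_radius[OF clinear_funpow[OF T_linear] num]
        by (intro A_opnorm_least) (metis mult_1_right)
      finally show ?thesis .
    qed
    then have le2: "(N / w) ^ (2 ^ k) \<le> 2" for k
      using \<open>w > 0\<close> by (simp add: power_divide field_simps)
    have "N / w > 1" using \<open>w < N\<close> \<open>w > 0\<close> by simp
    then obtain n where "(N / w) ^ n > 2" using real_arch_pow by blast
    moreover have "(N / w) ^ n \<le> (N / w) ^ (2 ^ n)"
      using \<open>N / w > 1\<close> less_exp[of n] by (intro power_increasing) auto
    ultimately show False using le2[of n] by linarith
  qed
qed

end

section \<open>The operator inequality and the combined equivalences\<close>

theorem theorem2p3:
  fixes A T :: "'a::chilbert_space \<Rightarrow> 'a"
  assumes "\<exists>x::'a. x \<noteq> 0"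
    and "bounded_clinear A" and "op_positive A" and "A \<noteq> (\<lambda>x. 0)"
    and "A_bounded A T"
  shows
    "(A_Davis_Wielandt_radius A T = sqrt ((A_numerical_radius A T)\<^sup>2 + A_opnorm A T ^ 4)
        \<longleftrightarrow> A_norm_parallel A T id)
     \<and> (A_norm_parallel A T id \<longleftrightarrow> A_normaloid A T)
     \<and> (A_normaloid A T
        \<longleftrightarrow> op_ge (\<lambda>x. (A_numerical_radius A T)\<^sup>2 *\<^sub>R A x) (cadjoint T \<circ> A \<circ> T))"
proof -
  interpret A_bounded_operator A T
    using assms by unfold_locales
  have T: "bounded_clinear T" using assms by (simp add: A_bounded_def)
  have 1: "cinner ((cadjoint T \<circ> A \<circ> T) x) x = of_real ((A_norm A (T x))\<^sup>2)" for x
  proof -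
    have "cinner ((cadjoint T \<circ> A \<circ> T) x) x = cnj (cinner x (cadjoint T (A (T x))))"
      by (simp add: cinner_commute[of "cadjoint T (A (T x))"])
    also have "\<dots> = cinner (A (T x)) (T x)"
      using cinner_commute[of "A (T x)" "T x"] by (simp flip: cinner_cadjoint[OF T])
    finally show ?thesis using self_eq[of "T x"] by (simp add: A_inner_def)
  qed
  have 2: "cinner (w\<^sup>2 *\<^sub>R A x) x = of_real (w\<^sup>2 * (A_norm A x)\<^sup>2)" for x
    using self_eq[of x] by (simp add: scaleC_of_real[symmetric] cinner_scaleC_left A_inner_def)
  \<comment> \<open>Both quadratic forms are real, so the complex order compares squared seminorms.
    The inequality then says that \<open>w\<close> is a bound for \<open>T\<close>, and
    \<open>N\<close> is the least such bound.\<close>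
  have "op_ge (\<lambda>x. w\<^sup>2 *\<^sub>R A x) (cadjoint T \<circ> A \<circ> T)
      \<longleftrightarrow> (\<forall>x. (A_norm A (T x))\<^sup>2 \<le> (w * A_norm A x)\<^sup>2)"
    unfolding op_ge_def 1 2 by (simp add: less_eq_complex_def power_mult_distrib)
  also have "\<dots> \<longleftrightarrow> (\<forall>x. A_norm A (T x) \<le> w * A_norm A x)"
    using w_nonneg by (simp add: power_mono_iff)
  also have "\<dots> \<longleftrightarrow> w = N"
  proof
    assume "\<forall>x. A_norm A (T x) \<le> w * A_norm A x"
    then have "N \<le> w" by (intro A_opnorm_least) (metis mult_1_right)
    then show "w = N" using w_le_N by simp
  next
    assume "w = N"
    then show "\<forall>x. A_norm A (T x) \<le> w * A_norm A x" using T_le by simp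
  qed
  finally show ?thesis
    using Davis_Wielandt_iff norm_parallel_iff normaloid_iff by blast
qed

end
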